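(* Let $X$ be a real Banach space and let $E\subseteq X$ be a subset. Then the following assertions are equivalent. (1) $E$ is compactivorous. (2) For every compact set $K\subset X$, there are $x\in X$ and $\delta>0$ such that $x+\delta K\subset E$. (3) There is $r>0$ with the property that, for every compact set $K\subset rB_X$, one can find an $x\in X$ such that $x+K\subset E$.
   Context: All Banach spaces are real (and not assumed separable). $B_X$ denotes the closed unit ball of $X$. A subset $E$ of a Banach space $X$ is called compactivorous if for every nonempty compact set $K\subset X$ there exist an open set $V\subseteq X$ and $x\in X$ such that $K\cap V\neq\varnothing$ and $x+(K\cap V)\subset E$. *)

theory Defs
  imports "HOL-Analysis.Analysis"
begin

definition compactivorous :: "'a::banach set \<Rightarrow> bool" where
  "compactivorous E \<longleftrightarrow>
    (\<forall>K. compact K \<and> K \<noteq> {} \<longrightarrow>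
      (\<exists>V x. open V \<and> K \<inter> V \<noteq> {} \<and> (\<lambda>y. x + y) ` (K \<inter> V) \<subseteq> E))"

end

theory Submission
  imports Defs
begin

text \<open>
  If (3) fails, there are compact sets \<open>K\<^sub>n\<close> in the ball of radius \<open>4\<^sup>-\<^sup>n\<close> no translate of which lies
  in \<open>E\<close>. Given compact sets \<open>L\<^sub>n\<close> containing \<open>0\<close> and lying in the ball of radius \<open>2\<^sup>-\<^sup>n\<close>, the set of
  all sums \<open>\<Sum> y\<^sub>n\<close> with \<open>y\<^sub>n \<in> L\<^sub>n\<close> is compact, contains every \<open>L\<^sub>n\<close>, and each of its nonempty
  relatively open subsets contains a translate of \<open>L\<^sub>n\<close> for all large \<open>n\<close>. Taking \<open>L\<^sub>n = K\<^sub>n \<union> {0}\<close>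
  contradicts (1); taking \<open>L\<^sub>n = 2\<^sup>n [0,1] K\<^sub>n\<close>, whose multiples by \<open>\<delta> \<ge> 2\<^sup>-\<^sup>n\<close> contain \<open>K\<^sub>n\<close>,
  contradicts (2).
\<close>

definition series_set :: "(nat \<Rightarrow> 'a::real_normed_vector set) \<Rightarrow> 'a set" where
  "series_set L = suminf ` {f. \<forall>n. f n \<in> L n}"

text \<open>The admissible choices of terms form a product of compact sets, compact by Tychonoff in
  the topology of pointwise convergence. On it the Weierstrass M-test makes \<open>suminf\<close> a
  uniform limit of continuous partial sums, hence continuous.\<close>

lemma compact_series_set:
  fixes L :: "nat \<Rightarrow> 'a::banach set"
  assumes compact: "\<And>n. compact (L n)"
    and bound: "\<And>n. L n \<subseteq> cball 0 (M n)"
    and M: "summable M"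
  shows "compact (series_set L)"
proof -
  let ?P = "{f. \<forall>n. f n \<in> L n}"
  have "?P = (\<Pi>\<^sub>E n\<in>UNIV. L n)"
    by (auto simp: PiE_def)
  then have "compact ?P"
    using compact compactin_PiE[of "\<lambda>_. euclidean" UNIV L]
    by (simp add: euclidean_product_topology)
  moreover have "continuous_on ?P suminf"
  proof (rule uniform_limit_theorem)
    show "uniform_limit ?P (\<lambda>n f. \<Sum>i<n. f i) suminf sequentially"
      using Weierstrass_m_test[of ?P "\<lambda>n f. f n" M] bound M by fastforce
    have "continuous_on ?P (\<lambda>f. f i)" for i
      by (rule continuous_on_subset[OF continuous_on_product_coordinates]) simp
    then show "\<forall>\<^sub>F n in sequentially. continuous_on ?P (\<lambda>f. \<Sum>i<n. f i)"
      by (intro always_eventually allI continuous_on_sum) auto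
  qed simp
  ultimately show ?thesis
    unfolding series_set_def by (rule compact_continuous_image[rotated])
qed

text \<open>Follow \<open>f\<close> below \<open>N\<close>, take \<open>y\<close> at
  \<open>N\<close> and choose 0 from every later set.\<close>

lemma partial_sum_add_in_series_set:
  assumes "\<And>n. 0 \<in> L n" "\<And>n. f n \<in> L n" "y \<in> L N"
  shows "(\<Sum>n<N. f n) + y \<in> series_set L"
proof -
  define g where "g n = (if n < N then f n else if n = N then y else 0)" for n
  have "suminf g = (\<Sum>n<Suc N. g n)"
    by (rule suminf_finite) (auto simp: g_def)
  also have "\<dots> = (\<Sum>n<N. f n) + y"
    by (simp add: g_def)
  finally have "(\<Sum>n<N. f n) + y = suminf g" ..
  moreover have "\<forall>n. g n \<in> L n"
    using assms by (auto simp: g_def)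
  ultimately show ?thesis
    unfolding series_set_def by blast
qed

text \<open>Around a point \<open>suminf f\<close> of \<open>V\<close>, truncating the series at a
  large \<open>n\<close> costs less than \<open>e / 2\<close>. Adding an arbitrary element of
  \<open>L n\<close> costs at most \<open>M n < e / 2\<close>, so the translate by the partial sum
  stays in the ball.\<close>

lemma open_inter_series_set_contains_translate:
  fixes L :: "nat \<Rightarrow> 'a::banach set"
  assumes zero: "\<And>n. 0 \<in> L n"
    and bound: "\<And>n. L n \<subseteq> cball 0 (M n)"
    and M: "summable M"
    and "open V" "series_set L \<inter> V \<noteq> {}"
  shows "\<exists>n s. (\<lambda>y. s + y) ` L n \<subseteq> series_set L \<inter> V"
proof -
  from assms obtain f where f: "\<And>n. f n \<in> L n" and "suminf f \<in> V"
    unfolding series_set_def by auto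
  with \<open>open V\<close> obtain e where "e > 0" and e: "ball (suminf f) e \<subseteq> V"
    using openE by blast
  have "norm (f n) \<le> M n" for n
    using subsetD[OF bound f] by simp
  then have "summable f"
    using summable_comparison_test'[OF M] by blast
  then have "\<forall>\<^sub>F n in sequentially. dist (\<Sum>i<n. f i) (suminf f) < e / 2"
    using \<open>e > 0\<close> by (intro tendstoD[OF summable_LIMSEQ]) auto
  moreover have "\<forall>\<^sub>F n in sequentially. M n < e / 2"
    using \<open>e > 0\<close> by (intro order_tendstoD(2)[OF summable_LIMSEQ_zero[OF M]]) auto
  ultimately have "\<forall>\<^sub>F n in sequentially. dist (\<Sum>i<n. f i) (suminf f) < e / 2 \<and> M n < e / 2"
    by (rule eventually_conj)
  then obtain n where n: "dist (\<Sum>i<n. f i) (suminf f) < e / 2" "M n < e / 2"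
    using eventually_happens'[OF sequentially_bot] by blast
  have "(\<Sum>i<n. f i) + y \<in> series_set L \<inter> V" if y: "y \<in> L n" for y
  proof
    show "(\<Sum>i<n. f i) + y \<in> series_set L"
      using zero f y by (rule partial_sum_add_in_series_set)
    have "norm y \<le> M n"
      using subsetD[OF bound y] by simp
    then have "dist (suminf f) ((\<Sum>i<n. f i) + y) < e"
      using n norm_triangle_ineq[of "(\<Sum>i<n. f i) - suminf f" y]
      by (simp add: dist_norm norm_minus_commute[of "suminf f"] algebra_simps)
    then show "(\<Sum>i<n. f i) + y \<in> V"
      using e by auto
  qed
  then show ?thesis by blast
qed

lemma subset_series_set:
  assumes "\<And>n. 0 \<in> L n"
  shows "L n \<subseteq> series_set L"
  using partial_sum_add_in_series_set[of L "\<lambda>_. 0"] assms by auto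

text \<open>Condition (3), with the scaled unit ball written as \<open>cball 0 r\<close>. Both other
  conditions are compared with this one.\<close>

definition contains_small_compacts :: "'a::real_normed_vector set \<Rightarrow> bool" where
  "contains_small_compacts E \<longleftrightarrow>
    (\<exists>r>0. \<forall>K. compact K \<and> K \<subseteq> cball 0 r \<longrightarrow> (\<exists>x. (\<lambda>y. x + y) ` K \<subseteq> E))"

text \<open>The radii \<open>(1/4)^n\<close> decay fast enough to remain summable after a dilation
  by \<open>2^n\<close>.\<close>

lemma not_contains_small_compactsD:
  fixes E :: "'a::real_normed_vector set"
  assumes "\<not> contains_small_compacts E"
  shows "\<exists>K. \<forall>n. compact (K n) \<and> K n \<subseteq> cball 0 ((1/4)^n) \<and> K n \<noteq> {} \<and> (\<forall>x. \<not> (\<lambda>y. x + y) ` K n \<subseteq> E)"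
proof (rule choice, rule allI)
  fix n :: nat
  have "(0::real) < (1/4)^n" by simp
  then obtain K where "compact K" "K \<subseteq> cball 0 ((1/4)^n)" and K: "\<And>x. \<not> (\<lambda>y. x + y) ` K \<subseteq> E"
    using assms unfolding contains_small_compacts_def by metis
  \<comment> \<open>Every translate of the empty set lies in \<open>E\<close>.\<close>
  moreover have "K \<noteq> {}"
    using K by auto
  ultimately show "\<exists>K. compact K \<and> K \<subseteq> cball 0 ((1/4)^n) \<and> K \<noteq> {} \<and> (\<forall>x. \<not> (\<lambda>y. x + y) ` K \<subseteq> E)"
    by auto
qed

lemma summable_half_powers: "summable (\<lambda>n. (1/2 :: real)^n)"
  by (rule summable_geometric) simp

lemma compactivorous_imp_contains_small_compacts:
  assumes "compactivorous E"
  shows "contains_small_compacts E"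
proof (rule ccontr)
  assume "\<not> contains_small_compacts E"
  from not_contains_small_compactsD[OF this] obtain K where
    "\<forall>n. compact (K n) \<and> K n \<subseteq> cball 0 ((1/4)^n) \<and> K n \<noteq> {} \<and> (\<forall>x. \<not> (\<lambda>y. x + y) ` K n \<subseteq> E)" ..
  then have K: "\<And>n. compact (K n)" "\<And>n. K n \<subseteq> cball 0 ((1/4)^n)"
    and not_E: "\<And>n x. \<not> (\<lambda>y. x + y) ` K n \<subseteq> E"
    by simp_all
  \<comment> \<open>Adjoining 0 permits truncated sums, and a translate of \<open>L n\<close> inside
    \<open>E\<close> still carries \<open>K n\<close> into \<open>E\<close>.\<close>
  define L where "L n = insert 0 (K n)" for n
  have "(1/4)^n \<le> (1/2 :: real)^n" for n
    by (rule power_mono) auto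
  then have L: "0 \<in> L n" "compact (L n)" "L n \<subseteq> cball 0 ((1/2)^n)" for n
    using K order_trans[OF K(2) subset_cball] unfolding L_def by auto
  have "series_set L \<noteq> {}"
    using subset_series_set[of L] L(1) by blast
  moreover have "compact (series_set L)"
    using L(2,3) summable_half_powers by (rule compact_series_set)
  ultimately have "\<exists>V x. open V \<and> series_set L \<inter> V \<noteq> {} \<and> (\<lambda>y. x + y) ` (series_set L \<inter> V) \<subseteq> E"
    using assms unfolding compactivorous_def by simp
  then obtain V x where "open V" "series_set L \<inter> V \<noteq> {}"
    and x: "(\<lambda>y. x + y) ` (series_set L \<inter> V) \<subseteq> E"
    by (elim exE conjE)
  then obtain n s where "(\<lambda>y. s + y) ` L n \<subseteq> series_set L \<inter> V"
    using open_inter_series_set_contains_translate[OF L(1,3) summable_half_powers] by blast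
  then have "(\<lambda>y. (x + s) + y) ` K n \<subseteq> E"
    using x unfolding L_def by (simp add: image_subset_iff add.assoc)
  then show False
    using not_E by blast
qed

lemma contains_small_compacts_imp_compactivorous:
  fixes E :: "'a::banach set"
  assumes "contains_small_compacts E"
  shows "compactivorous E"
  unfolding compactivorous_def
proof (intro allI impI)
  fix K :: "'a set"
  assume "compact K \<and> K \<noteq> {}"
  then obtain k where "compact K" "k \<in> K" by blast
  from assms obtain r where "r > 0"
    and r: "\<And>K. compact K \<Longrightarrow> K \<subseteq> cball 0 r \<Longrightarrow> \<exists>x. (\<lambda>y. x + y) ` K \<subseteq> E"
    unfolding contains_small_compacts_def by blast
  \<comment> \<open>The closed ball keeps this piece of \<open>K\<close> compact; the open ball with
    the same centre and radius then serves as \<open>V\<close>.\<close>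
  let ?K' = "(\<lambda>y. - k + y) ` (K \<inter> cball k r)"
  have "compact ?K'"
    using \<open>compact K\<close> by (intro compact_translation compact_Int_closed) auto
  moreover have "?K' \<subseteq> cball 0 r"
    by (auto simp: dist_norm norm_minus_commute)
  ultimately obtain x where "(\<lambda>y. x + y) ` ?K' \<subseteq> E"
    using r by blast
  then have "(\<lambda>y. (x - k) + y) ` (K \<inter> ball k r) \<subseteq> E"
    by (auto simp: algebra_simps image_subset_iff)
  moreover have "K \<inter> ball k r \<noteq> {}"
    using \<open>k \<in> K\<close> \<open>r > 0\<close> by auto
  ultimately show "\<exists>V x. open V \<and> K \<inter> V \<noteq> {} \<and> (\<lambda>y. x + y) ` (K \<inter> V) \<subseteq> E"
    using open_ball by blast
qed

text \<open>A compact set is bounded, by \<open>b\<close> say, so the factor \<open>r / b\<close>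
  shrinks it into the ball of radius \<open>r\<close>.\<close>

lemma contains_small_compacts_imp_scaled_compact:
  fixes E :: "'a::real_normed_vector set"
  assumes "contains_small_compacts E" "compact K"
  shows "\<exists>x. \<exists>\<delta>>0. (\<lambda>y. x + \<delta> *\<^sub>R y) ` K \<subseteq> E"
proof -
  from assms(1) obtain r where "r > 0"
    and r: "\<And>K. compact K \<Longrightarrow> K \<subseteq> cball 0 r \<Longrightarrow> \<exists>x. (\<lambda>y. x + y) ` K \<subseteq> E"
    unfolding contains_small_compacts_def by blast
  obtain b where "b > 0" and b: "\<And>y. y \<in> K \<Longrightarrow> norm y \<le> b"
    using compact_imp_bounded[OF assms(2)] bounded_pos by metis
  have "(\<lambda>y. (r / b) *\<^sub>R y) ` K \<subseteq> cball 0 r"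
    using b \<open>b > 0\<close> \<open>r > 0\<close> by (auto simp: field_simps)
  then obtain x where "(\<lambda>y. x + y) ` (\<lambda>y. (r / b) *\<^sub>R y) ` K \<subseteq> E"
    using r[OF compact_scaling[OF assms(2)]] by blast
  then show ?thesis
    using \<open>b > 0\<close> \<open>r > 0\<close> by (intro exI[of _ x] exI[of _ "r / b"]) auto
qed

text \<open>The factor \<delta> is known only after the compact set is fixed, so this set must
  contain \<open>(1 / \<delta>) *\<^sub>R y\<close> for all \<open>y\<close> in some
  \<open>K n\<close>, whatever \<delta> turns out to be.\<close>

lemma scaled_compacts_imp_contains_small_compacts:
  fixes E :: "'a::banach set"
  assumes scaled: "\<And>K. compact K \<Longrightarrow> \<exists>x. \<exists>\<delta>>0. (\<lambda>y. x + \<delta> *\<^sub>R y) ` K \<subseteq> E"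
  shows "contains_small_compacts E"
proof (rule ccontr)
  assume "\<not> contains_small_compacts E"
  from not_contains_small_compactsD[OF this] obtain K where
    "\<forall>n. compact (K n) \<and> K n \<subseteq> cball 0 ((1/4)^n) \<and> K n \<noteq> {} \<and> (\<forall>x. \<not> (\<lambda>y. x + y) ` K n \<subseteq> E)" ..
  then have K: "\<And>n. compact (K n)" "\<And>n. K n \<subseteq> cball 0 ((1/4)^n)" "\<And>n. K n \<noteq> {}"
    and not_E: "\<And>n x. \<not> (\<lambda>y. x + y) ` K n \<subseteq> E"
    by simp_all
  define L where "L n = (\<lambda>(t, y). (2^n * t) *\<^sub>R y) ` ({0..1} \<times> K n)" for n
  \<comment> \<open>Take \<open>t = 0\<close> with any point of the nonempty set
    \<open>K n\<close>.\<close>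
  have zero: "0 \<in> L n" for n
    using K(3)[of n] unfolding L_def by force
  have "compact (L n)" for n
    unfolding L_def using K(1)
    by (intro compact_continuous_image compact_Times)
      (auto simp: case_prod_unfold intro!: continuous_intros)
  moreover have "L n \<subseteq> cball 0 ((1/2)^n)" for n
  proof -
    have "2^n * t * norm y \<le> (1/2)^n" if "0 \<le> t" "t \<le> 1" "y \<in> K n" for t y
    proof -
      have "norm y \<le> (1/4)^n"
        using K(2)[of n] that by auto
      then have "2^n * t * norm y \<le> 2^n * 1 * (1/4)^n"
        using that by (intro mult_mono) auto
      also have "\<dots> = (1/2)^n"
        by (simp flip: power_mult_distrib)
      finally show ?thesis .
    qed
    then show ?thesis
      unfolding L_def by auto
  qed
  ultimately have "compact (series_set L)"
    using summable_half_powers by (rule compact_series_set)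
  then obtain x \<delta> where "\<delta> > 0" and x: "(\<lambda>y. x + \<delta> *\<^sub>R y) ` series_set L \<subseteq> E"
    using scaled by blast
  obtain n where n: "1 / \<delta> < 2^n"
    using real_arch_pow[of 2 "1 / \<delta>"] by auto
  have "x + y \<in> E" if "y \<in> K n" for y
  proof -
    \<comment> \<open>This is the parameter \<open>t\<close> with
      \<open>2^n * t = 1 / \<delta>\<close>; the choice of \<open>n\<close> keeps it below
      1.\<close>
    have "1 / (\<delta> * 2^n) \<in> {0..1}"
      using n \<open>\<delta> > 0\<close> by (auto simp: field_simps)
    then have "(2^n * (1 / (\<delta> * 2^n))) *\<^sub>R y \<in> L n"
      using that unfolding L_def by (intro image_eqI[of _ _ "(1 / (\<delta> * 2^n), y)"]) auto
    then have "(1 / \<delta>) *\<^sub>R y \<in> series_set L"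
      using subset_series_set[of L n] zero by auto
    then have "x + \<delta> *\<^sub>R (1 / \<delta>) *\<^sub>R y \<in> E"
      using x by blast
    then show ?thesis
      using \<open>\<delta> > 0\<close> by simp
  qed
  then show False
    using not_E[of x n] by blast
qed

theorem theorem4p3:
  fixes E :: "'a::banach set"
  shows "(compactivorous E \<longleftrightarrow>
           (\<forall>K. compact K \<longrightarrow> (\<exists>x. \<exists>\<delta>>0. (\<lambda>y. x + \<delta> *\<^sub>R y) ` K \<subseteq> E)))
       \<and> (compactivorous E \<longleftrightarrow>
           (\<exists>r>0. \<forall>K. compact K \<and> K \<subseteq> (\<lambda>y. r *\<^sub>R y) ` cball 0 1 \<longrightarrow>
             (\<exists>x. (\<lambda>y. x + y) ` K \<subseteq> E)))"
proof -
  have "(\<lambda>y. r *\<^sub>R y) ` cball 0 1 = cball (0::'a) r" if "r > 0" for r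
    using that cball_scale[of r "0::'a" 1] by simp
  then have "contains_small_compacts E \<longleftrightarrow>
      (\<exists>r>0. \<forall>K. compact K \<and> K \<subseteq> (\<lambda>y. r *\<^sub>R y) ` cball 0 1 \<longrightarrow>
        (\<exists>x. (\<lambda>y. x + y) ` K \<subseteq> E))"
    unfolding contains_small_compacts_def by (simp cong: conj_cong)
  moreover have "compactivorous E \<longleftrightarrow> contains_small_compacts E"
    using compactivorous_imp_contains_small_compacts contains_small_compacts_imp_compactivorous
    by blast
  moreover have "contains_small_compacts E \<longleftrightarrow>
      (\<forall>K. compact K \<longrightarrow> (\<exists>x. \<exists>\<delta>>0. (\<lambda>y. x + \<delta> *\<^sub>R y) ` K \<subseteq> E))"
    using contains_small_compacts_imp_scaled_compact[of E]
      scaled_compacts_imp_contains_small_compacts[of E]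
    by blast
  ultimately show ?thesis by simp
qed

end
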